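(* Let $B$ be a standard Brownian motion, $\alpha>0$, and let $L_b,K_b,K_\sigma\ge 0$ be constants. Let $\overline{b}:\mathbb{R}_+\times\mathbb{R}\to\mathbb{R}$ satisfy $|\overline{b}(t,x)-\overline{b}(t,y)|\le L_b|x-y|$ and $|\overline{b}(t,x)|\le K_b$ for all $t\ge 0$, $x,y\in\mathbb{R}$, and let $\overline{\sigma}:\mathbb{R}_+\to\mathbb{R}$ (a diffusion coefficient independent of the space variable) satisfy $\overline{\sigma}(t)^2\le K_\sigma$ for all $t\ge 0$. Let $D_b,D_\sigma,D_x$ be real constants and $\overline{x}_0\in\mathbb{R}$. For all $N>2$ let $$b^N(t,x):=\overline{b}(t,x)+N^{-\alpha}D_b,\qquad \sigma^N(t)^2:=\overline{\sigma}(t)^2+N^{-2\alpha}D_\sigma,\qquad x_0^N:=\overline{x}_0+N^{-\alpha}D_x,$$ ($D_\sigma$ being such that $\overline{\sigma}(t)^2+N^{-2\alpha}D_\sigma\ge 0$), and let $X^N$ and $\overline{X}$ satisfy, for all $t\ge0$, $$X^N(t)=x_0^N+\int_0^t b^N(s,X^N(s))\,ds+B(\Lambda^N(t)),\qquad \overline{X}(t)=\overline{x}_0+\int_0^t\overline{b}(s,\overline{X}(s))\,ds+B(\overline{\Lambda}(t)),$$ where $\Lambda^N(t):=\int_0^t\sigma^N(s)^2ds$ and $\overline{\Lambda}(t):=\int_0^t\overline{\sigma}(s)^2ds$. Let $\eta>0$. Then there exists a random variable $\Xi$ (not depending on $N$) such that $\Xi^2$ admits exponential moments and, for all $N>2$,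 $$\sup_{0\le t<\infty}\frac{|X^N(t)-\overline{X}(t)|}{e^{2(L_b+\eta)t}}\le \Xi\,\frac{\ln N}{N^\alpha}.$$
   Context: A nonnegative random variable $Z$ is said to admit exponential moments if $\mathbb{E}[\exp(\lambda Z)]<\infty$ for some $\lambda>0$. Standing assumption: the equations for $X^N$ and $\overline{X}$ (driven by the same Brownian motion $B$) admit strong solutions with continuous paths. Inequalities between random variables are understood almost surely. *)

theory Defs
  imports "HOL-Probability.Probability"
begin

locale standard_brownian_motion = prob_space M
  for M :: "'a measure" +
  fixes B :: "real \<Rightarrow> 'a \<Rightarrow> real"
  assumes measurable: "\<And>t. 0 \<le> t \<Longrightarrow> B t \<in> borel_measurable M"
    and starts_at_zero: "AE \<omega> in M. B 0 \<omega> = 0"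
    and gaussian_increments:
      "\<And>s t. 0 \<le> s \<Longrightarrow> s < t \<Longrightarrow>
        distributed M lborel (\<lambda>\<omega>. B t \<omega> - B s \<omega>) (normal_density 0 (sqrt (t - s)))"
    and independent_increments:
      "\<And>(\<tau> :: nat \<Rightarrow> real) n. 0 \<le> \<tau> 0 \<Longrightarrow> mono \<tau> \<Longrightarrow>
        indep_vars (\<lambda>_. borel) (\<lambda>i \<omega>. B (\<tau> (Suc i)) \<omega> - B (\<tau> i) \<omega>) {..<n}"
    and continuous_paths: "AE \<omega> in M. continuous_on {0..} (\<lambda>t. B t \<omega>)"

definition admits_exponential_moments :: "'a measure \<Rightarrow> ('a \<Rightarrow> real) \<Rightarrow> bool" where
  "admits_exponential_moments M Z \<longleftrightarrow>
     Z \<in> borel_measurable M \<and> (AE \<omega> in M. 0 \<le> Z \<omega>) \<and>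
     (\<exists>l>0. (\<integral>\<^sup>+\<omega>. ennreal (exp (l * Z \<omega>)) \<partial>M) < \<infinity>)"

definition clock :: "(real \<Rightarrow> real) \<Rightarrow> real \<Rightarrow> real" where
  "clock \<sigma> t = integral {0..t} (\<lambda>s. (\<sigma> s)\<^sup>2)"

text \<open>Continuous solutions, on the given probability space and with the given driving
  process \<open>B\<close>, of \<open>X t = x0 + (integral of b s (X s) over [0,t]) + B (clock \<sigma> t)\<close>.
  The two integrability clauses say that the integrals in the equation exist.
  For bounded integrands the gauge integral on a compact interval agrees with the Lebesgue
  integral, and integrability amounts to Lebesgue measurability. No separate
  measurability of \<open>b\<close> and \<open>\<sigma>\<close> is required.\<close>

definition time_changed_solution ::
  "'a measure \<Rightarrow> (real \<Rightarrow> 'a \<Rightarrow> real) \<Rightarrow> (real \<Rightarrow> real \<Rightarrow> real) \<Rightarrow> (real \<Rightarrow> real) \<Rightarrow> real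
    \<Rightarrow> (real \<Rightarrow> 'a \<Rightarrow> real) \<Rightarrow> bool" where
  "time_changed_solution M B b \<sigma> x0 X \<longleftrightarrow>
     (\<forall>t\<ge>0. X t \<in> borel_measurable M) \<and>
     (\<forall>t\<ge>0. (\<lambda>s. (\<sigma> s)\<^sup>2) integrable_on {0..t}) \<and>
     (AE \<omega> in M.
        continuous_on {0..} (\<lambda>t. X t \<omega>) \<and>
        (\<forall>t\<ge>0. (\<lambda>s. b s (X s \<omega>)) integrable_on {0..t} \<and>
           X t \<omega> = x0 + integral {0..t} (\<lambda>s. b s (X s \<omega>)) + B (clock \<sigma> t) \<omega>))"

end

theory Submission imports Defs begin

text \<open>The difference of the two solutions is controlled by a Gronwall estimate, in which the
  only random term is \<open>B (clock \<sigma>\<^sub>N t) - B (clock \<sigma> t)\<close>, and the clocks differ by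
  \<open>D_\<sigma> * t / N powr (2 * \<alpha>)\<close>. Chaining along dyadic points gives \<open>B\<close> the modulus of
  continuity \<open>sqrt h * ln (1 / h)\<close>, which produces the rate \<open>ln N / N powr \<alpha>\<close>. The random
  constant comes from one integrable weighted sum \<open>W\<close> of \<open>exp (Z\<^sup>2 / 4)\<close> over all normalised
  dyadic increments \<open>Z\<close> of \<open>B\<close> on \<open>[0, \<infinity>)\<close>: each \<open>Z\<^sup>2\<close> is at most \<open>4 * ln W\<close>
  plus the logarithm of an inverse weight, and \<open>exp (ln W) = W\<close> is integrable, so
  \<open>\<Xi>\<close> of order \<open>1 + sqrt (ln W)\<close> has a square with exponential moments. The growth in \<open>t\<close> is
  polynomial and is absorbed by \<open>exp (2 * \<eta> * t)\<close>.\<close>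

section \<open>Gronwall estimate in an exponentially weighted supremum norm\<close>

lemma weighted_gronwall:
  fixes u :: "real \<Rightarrow> real"
  assumes cont: "continuous_on {0..} u" and nonneg: "\<And>s. 0 \<le> s \<Longrightarrow> 0 \<le> u s"
    and "0 \<le> L" "0 < \<kappa>" "2 * L \<le> \<kappa>"
    and bound: "\<And>s. 0 \<le> s \<Longrightarrow> u s \<le> A * exp (\<kappa> * s) + L * integral {0..s} u"
    and "0 \<le> t"
  shows "u t \<le> 2 * A * exp (\<kappa> * t)"
proof -
  \<comment> \<open>Evaluate the hypothesis at a maximum of \<open>u / exp (\<kappa> * _)\<close>, where the integral term is
    at most half of the maximum.\<close>
  define g where "g s = u s / exp (\<kappa> * s)" for s
  have "continuous_on {0..t} g"
    unfolding g_def by (intro continuous_intros continuous_on_subset[OF cont]) auto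
  then obtain s where s: "s \<in> {0..t}" "\<And>r. r \<in> {0..t} \<Longrightarrow> g r \<le> g s"
    using continuous_attains_sup[of "{0..t}" g] \<open>0 \<le> t\<close> by auto
  define S where "S = g s"
  have S0: "0 \<le> S"
    using nonneg s(1) by (simp add: S_def g_def)
  have u_le: "u r \<le> S * exp (\<kappa> * r)" if "r \<in> {0..t}" for r
    using s(2)[OF that] by (simp add: S_def g_def field_simps)
  have exp_int: "((\<lambda>r. S * exp (\<kappa> * r)) has_integral
      S * exp (\<kappa> * s) / \<kappa> - S * exp (\<kappa> * 0) / \<kappa>) {0..s}"
    using s(1) \<open>0 < \<kappa>\<close>
    by (intro fundamental_theorem_of_calculus)
      (auto intro!: derivative_eq_intros simp flip: has_real_derivative_iff_has_vector_derivative)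
  have "integral {0..s} u \<le> integral {0..s} (\<lambda>r. S * exp (\<kappa> * r))"
    using s(1) u_le
    by (intro integral_le integrable_continuous_real continuous_on_subset[OF cont]
        continuous_intros) auto
  also have "\<dots> \<le> S * exp (\<kappa> * s) / \<kappa>"
    unfolding integral_unique[OF exp_int] using S0 \<open>0 < \<kappa>\<close> by simp
  finally have "L * integral {0..s} u \<le> L * (S * exp (\<kappa> * s) / \<kappa>)"
    using \<open>0 \<le> L\<close> by (rule mult_left_mono)
  also have "\<dots> = (L / \<kappa>) * (S * exp (\<kappa> * s))"
    by simp
  also have "\<dots> \<le> (1 / 2) * (S * exp (\<kappa> * s))"
    using S0 assms by (intro mult_right_mono) (auto simp: field_simps)
  finally have "u s \<le> (A + S / 2) * exp (\<kappa> * s)"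
    using bound[of s] s(1) by (simp add: field_simps)
  \<comment> \<open>At the maximiser \<open>u s\<close> equals
    \<open>S * exp (\<kappa> * s)\<close>, so the exponential cancels and \<open>S / 2\<close> can
    be absorbed into the left side.\<close>
  then have "S \<le> A + S / 2"
    by (simp add: S_def g_def field_simps)
  then have "S \<le> 2 * A" by simp
  then have "S * exp (\<kappa> * t) \<le> 2 * A * exp (\<kappa> * t)"
    by simp
  moreover have "u t \<le> S * exp (\<kappa> * t)"
    using u_le \<open>0 \<le> t\<close> by simp
  ultimately show ?thesis
    by (rule order_trans[rotated])
qed

section \<open>Modulus of continuity from bounds on dyadic increments\<close>

lemma floor_double_cases:
  fixes x :: real
  shows "\<lfloor>2 * x\<rfloor> = 2 * \<lfloor>x\<rfloor> \<or> \<lfloor>2 * x\<rfloor> = 2 * \<lfloor>x\<rfloor> + 1"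
  by linarith

lemma dyadic_floor_LIMSEQ:
  fixes u :: real
  shows "(\<lambda>k. of_int \<lfloor>u * 2 ^ k\<rfloor> / 2 ^ k) \<longlonglongrightarrow> u"
proof (rule real_tendsto_sandwich)
  show "\<forall>\<^sub>F k in sequentially. u - (1 / 2) ^ k \<le> of_int \<lfloor>u * 2 ^ k\<rfloor> / 2 ^ k"
  proof (intro always_eventually allI)
    fix k
    have "u * 2 ^ k - 1 \<le> of_int \<lfloor>u * 2 ^ k\<rfloor>" by linarith
    then have "(u * 2 ^ k - 1) / 2 ^ k \<le> of_int \<lfloor>u * 2 ^ k\<rfloor> / 2 ^ k"
      by (rule divide_right_mono) simp
    then show "u - (1 / 2) ^ k \<le> of_int \<lfloor>u * 2 ^ k\<rfloor> / 2 ^ k"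
      by (simp add: diff_divide_distrib power_divide)
  qed
  show "\<forall>\<^sub>F k in sequentially. of_int \<lfloor>u * 2 ^ k\<rfloor> / 2 ^ k \<le> u"
    by (intro always_eventually allI) (simp add: field_simps)
  have "(\<lambda>k. u - (1 / 2) ^ k) \<longlonglongrightarrow> u - 0"
    by (intro tendsto_intros LIMSEQ_power_zero) simp
  then show "(\<lambda>k. u - (1 / 2) ^ k) \<longlonglongrightarrow> u" by simp
qed simp

text \<open>\<open>sqrt (1 / 2) ^ m\<close> is the standard deviation of a Brownian increment over a
  mesh interval of length \<open>2 ^ -m\<close>.\<close>

lemma sqrt_half_power_square: "(sqrt (1 / 2) ^ m)\<^sup>2 = (1 / 2) ^ m"
  unfolding power2_eq_square power_mult_distrib[symmetric] by simp

text \<open>The dyadic floors of \<open>u\<close> converge to \<open>u\<close>, and consecutive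
  floors differ by at most one increment of the finer level. These increments decay geometrically up
  to a linear factor, so their sum has the order of its first term; continuity carries the bound
  over to \<open>u\<close>.\<close>

lemma dyadic_chaining:
  fixes f :: "real \<Rightarrow> real"
  assumes cont: "continuous_on {0..} f" and "0 \<le> A" "0 \<le> c"
    and incr: "\<And>k j. real j < T * 2 ^ k \<Longrightarrow>
      \<bar>f ((real j + 1) / 2 ^ k) - f (real j / 2 ^ k)\<bar> \<le> c * sqrt (1 / 2) ^ k * (A + real k)"
    and "0 \<le> u" "u < T"
  shows "\<bar>f u - f (of_int \<lfloor>u * 2 ^ m\<rfloor> / 2 ^ m)\<bar> \<le> 4 * c * sqrt (1 / 2) ^ m * (A + real m + 4)"
proof -
  define r :: real where "r = sqrt (1 / 2)"
  have r: "0 \<le> r" "r \<le> 3 / 4"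
    unfolding r_def by (simp, rule real_le_lsqrt) (simp_all add: power2_eq_square)
  define x :: "nat \<Rightarrow> real" where "x k = of_int \<lfloor>u * 2 ^ k\<rfloor> / 2 ^ k" for k
  \<comment> \<open>\<open>\<gamma> m\<close> is a closed-form bound of the sum of the dyadic increments at all levels above \<open>m\<close>,
    so the chaining sum telescopes.\<close>
  define \<gamma> where "\<gamma> k = 4 * c * r ^ k * (A + real k + 4)" for k
  have \<gamma>_nonneg: "0 \<le> \<gamma> k" for k
    using assms r by (simp add: \<gamma>_def)
  have step: "\<bar>f (x (Suc k)) - f (x k)\<bar> \<le> c * r ^ Suc k * (A + real (Suc k))" for k
  proof -
    \<comment> \<open>The floor at level \<open>k\<close> sits at the even index \<open>j\<close> of
      level \<open>Suc k\<close>, so passing to the finer floor costs either nothing or the single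
      increment that starts there.\<close>
    define j where "j = nat (2 * \<lfloor>u * 2 ^ k\<rfloor>)"
    have j: "real j = 2 * of_int \<lfloor>u * 2 ^ k\<rfloor>"
      using \<open>0 \<le> u\<close> by (simp add: j_def)
    have xk: "x k = real j / 2 ^ Suc k"
      by (simp add: x_def j)
    from floor_double_cases[of "u * 2 ^ k"]
    have "x (Suc k) = x k \<or> x (Suc k) = (real j + 1) / 2 ^ Suc k"
      by (auto simp: x_def j mult.commute mult.left_commute)
    then show ?thesis
    proof
      assume "x (Suc k) = x k"
      then show ?thesis using r assms by simp
    next
      assume *: "x (Suc k) = (real j + 1) / 2 ^ Suc k"
      have "real j \<le> u * 2 ^ Suc k"
        unfolding j by simp
      also have "\<dots> < T * 2 ^ Suc k"
        using \<open>u < T\<close> by (intro mult_strict_right_mono) auto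
      finally show ?thesis
        unfolding * unfolding xk r_def by (rule incr)
    qed
  qed
  \<comment> \<open>With \<open>y = A + real k\<close>, the right side minus the left is
    \<open>c * r ^ k\<close> times \<open>y * (4 - 5 * r) + (16 - 21 * r)\<close>. Both summands are
    nonnegative because \<open>r \<le> 3 / 4\<close>.\<close>
  have \<gamma>_step: "c * r ^ Suc k * (A + real (Suc k)) \<le> \<gamma> k - \<gamma> (Suc k)" for k
  proof -
    define y where "y = A + real k"
    have "0 \<le> y" using \<open>0 \<le> A\<close> by (simp add: y_def)
    then have "0 \<le> y * (4 - 5 * r)"
      using r by (intro mult_nonneg_nonneg) auto
    then have "0 \<le> 4 * (y + 4) - 4 * r * (y + 5) - r * (y + 1)"
      using r by (simp add: algebra_simps)
    then have "0 \<le> c * r ^ k * (4 * (y + 4) - 4 * r * (y + 5) - r * (y + 1))"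
      using assms r by simp
    then show ?thesis
      by (simp add: \<gamma>_def y_def algebra_simps)
  qed
  have tele: "\<bar>f (x (m + n)) - f (x m)\<bar> \<le> \<gamma> m - \<gamma> (m + n)" for n
  proof (induction n)
    case (Suc n)
    with step[of "m + n"] \<gamma>_step[of "m + n"] show ?case
      unfolding add_Suc_right by linarith
  qed simp
  have x_nonneg: "0 \<le> x k" for k
    using \<open>0 \<le> u\<close> by (simp add: x_def)
  have "(\<lambda>n. x (n + m)) \<longlonglongrightarrow> u"
    unfolding x_def using dyadic_floor_LIMSEQ by (rule LIMSEQ_ignore_initial_segment)
  then have "(\<lambda>n. f (x (n + m))) \<longlonglongrightarrow> f u"
    using \<open>0 \<le> u\<close> x_nonneg by (intro continuous_on_tendsto_compose[OF cont]) auto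
  then have "(\<lambda>n. \<bar>f (x (n + m)) - f (x m)\<bar>) \<longlonglongrightarrow> \<bar>f u - f (x m)\<bar>"
    by (intro tendsto_intros)
  moreover have "\<bar>f (x (n + m)) - f (x m)\<bar> \<le> \<gamma> m" for n
    using tele[of n] \<gamma>_nonneg[of "m + n"] by (simp add: add.commute)
  ultimately have "\<bar>f u - f (x m)\<bar> \<le> \<gamma> m"
    by (intro tendsto_upperbound[OF _ always_eventually]) auto
  then show ?thesis
    by (simp add: x_def \<gamma>_def r_def)
qed

lemma abs_diff_le_steps:
  fixes g :: "nat \<Rightarrow> real"
  assumes "p \<le> q" and "\<And>j. p \<le> j \<Longrightarrow> j < q \<Longrightarrow> \<bar>g (Suc j) - g j\<bar> \<le> \<beta>"
  shows "\<bar>g q - g p\<bar> \<le> real (q - p) * \<beta>"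
proof -
  have "\<bar>g q - g p\<bar> = \<bar>\<Sum>j=p..<q. g (Suc j) - g j\<bar>"
    using \<open>p \<le> q\<close> by (simp add: sum_Suc_diff')
  also have "\<dots> \<le> (\<Sum>j=p..<q. \<bar>g (Suc j) - g j\<bar>)"
    by (rule sum_abs)
  also have "\<dots> \<le> (\<Sum>j=p..<q. \<beta>)"
    using assms(2) by (intro sum_mono) auto
  finally show ?thesis by simp
qed

text \<open>The way from \<open>u\<close> to \<open>v\<close> leads through their floors at level
  \<open>m\<close>. Chaining costs four units at each end, and the floors are at most
  \<open>|v - u| * 2 ^ m + 1\<close> mesh steps apart, whence the 9. The level \<open>m\<close>
  stays free so that it can be adapted to the distance.\<close>

lemma dyadic_modulus:
  fixes f :: "real \<Rightarrow> real"
  assumes cont: "continuous_on {0..} f" and A: "0 \<le> A" "0 \<le> c"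
    and incr: "\<And>k j. real j < T * 2 ^ k \<Longrightarrow>
      \<bar>f ((real j + 1) / 2 ^ k) - f (real j / 2 ^ k)\<bar> \<le> c * sqrt (1 / 2) ^ k * (A + real k)"
    and u: "0 \<le> u" "u < T" and v: "0 \<le> v" "v < T"
  shows "\<bar>f v - f u\<bar> \<le> c * sqrt (1 / 2) ^ m * (\<bar>v - u\<bar> * 2 ^ m + 9) * (A + real m + 4)"
  using u v
proof (induction u v rule: linorder_wlog)
  case (le u v)
  define \<beta> where "\<beta> = c * sqrt (1 / 2) ^ m * (A + real m)"
  define \<delta> where "\<delta> = c * sqrt (1 / 2) ^ m * (A + real m + 4)"
  have \<beta>: "0 \<le> \<beta>" "\<beta> \<le> \<delta>"
    using A by (auto simp: \<beta>_def \<delta>_def intro!: mult_left_mono)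
  define p q where "p = nat \<lfloor>u * 2 ^ m\<rfloor>" and "q = nat \<lfloor>v * 2 ^ m\<rfloor>"
  have pq: "real p = of_int \<lfloor>u * 2 ^ m\<rfloor>" "real q = of_int \<lfloor>v * 2 ^ m\<rfloor>"
    using le by (auto simp: p_def q_def)
  have "p \<le> q"
    using le by (auto simp: p_def q_def intro!: nat_mono floor_mono mult_right_mono)
  have "\<bar>f (real q / 2 ^ m) - f (real p / 2 ^ m)\<bar> \<le> real (q - p) * \<beta>"
  proof (rule abs_diff_le_steps[OF \<open>p \<le> q\<close>, where g = "\<lambda>j. f (real j / 2 ^ m)"])
    fix j assume "j < q"
    then have "real j < real q" by simp
    also have "\<dots> \<le> v * 2 ^ m" unfolding pq by simp
    also have "\<dots> < T * 2 ^ m"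
      using le by (intro mult_strict_right_mono) auto
    finally show "\<bar>f (real (Suc j) / 2 ^ m) - f (real j / 2 ^ m)\<bar> \<le> \<beta>"
      using incr[of j m] by (simp add: \<beta>_def add.commute)
  qed
  also have "\<dots> \<le> (\<bar>v - u\<bar> * 2 ^ m + 1) * \<beta>"
  proof (rule mult_right_mono[OF _ \<beta>(1)])
    have "real q \<le> v * 2 ^ m" "u * 2 ^ m - 1 \<le> real p"
      unfolding pq by linarith+
    then show "real (q - p) \<le> \<bar>v - u\<bar> * 2 ^ m + 1"
      using le \<open>p \<le> q\<close> by (simp add: algebra_simps)
  qed
  also have "\<dots> \<le> (\<bar>v - u\<bar> * 2 ^ m + 1) * \<delta>"
    using \<beta> by (intro mult_left_mono) auto
  finally have "\<bar>f (real q / 2 ^ m) - f (real p / 2 ^ m)\<bar> \<le> (\<bar>v - u\<bar> * 2 ^ m + 1) * \<delta>" .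
  moreover have "\<bar>f u - f (real p / 2 ^ m)\<bar> \<le> 4 * \<delta>" "\<bar>f v - f (real q / 2 ^ m)\<bar> \<le> 4 * \<delta>"
    using dyadic_chaining[OF cont A incr, of T u m] dyadic_chaining[OF cont A incr, of T v m] le
    by (auto simp: pq \<delta>_def algebra_simps)
  ultimately have "\<bar>f v - f u\<bar> \<le> (\<bar>v - u\<bar> * 2 ^ m + 1) * \<delta> + 8 * \<delta>"
    by linarith
  then show ?case
    by (simp add: \<delta>_def algebra_simps)
next
  case (sym u v)
  then show ?case by (simp add: abs_minus_commute)
qed

section \<open>Square-exponential moments of the dyadic Brownian increments\<close>

context standard_brownian_motion
begin

text \<open>The factor 1/4 uses up only half of the Gaussian exponent 1/2: the integrand times the
  density is \<open>sqrt 2\<close> times the centred normal density of doubled variance.\<close>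

lemma nn_integral_exp_square_increment:
  assumes "0 \<le> s" "s < t"
  shows "(\<integral>\<^sup>+\<omega>. ennreal (exp ((B t \<omega> - B s \<omega>)\<^sup>2 / (4 * (t - s)))) \<partial>M) = ennreal (sqrt 2)"
proof -
  define h where "h = t - s"
  have h: "0 < h" using assms by (simp add: h_def)
  have density: "normal_density 0 (sqrt h) x * exp (x\<^sup>2 / (4 * h))
      = sqrt 2 * normal_density 0 (sqrt (2 * h)) x" for x
  proof -
    have "- x\<^sup>2 / (2 * h) + x\<^sup>2 / (4 * h) = - x\<^sup>2 / (4 * h)"
      using h by (simp add: field_simps)
    then have "exp (- x\<^sup>2 / (2 * h)) * exp (x\<^sup>2 / (4 * h)) = exp (- x\<^sup>2 / (4 * h))"
      by (simp flip: exp_add)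
    then show ?thesis
      using h by (simp add: normal_density_def real_sqrt_mult field_simps)
  qed
  have "(\<integral>\<^sup>+\<omega>. ennreal (exp ((B t \<omega> - B s \<omega>)\<^sup>2 / (4 * h))) \<partial>M)
      = (\<integral>\<^sup>+x. ennreal (normal_density 0 (sqrt h) x) * ennreal (exp (x\<^sup>2 / (4 * h))) \<partial>lborel)"
    by (rule distributed_nn_integral[OF gaussian_increments[OF assms, folded h_def], symmetric]) simp
  also have "\<dots> = (\<integral>\<^sup>+x. ennreal (sqrt 2) * ennreal (normal_density 0 (sqrt (2 * h)) x) \<partial>lborel)"
    by (intro nn_integral_cong) (simp add: density flip: ennreal_mult)
  also have "\<dots> = ennreal (sqrt 2) * (\<integral>\<^sup>+x. ennreal (normal_density 0 (sqrt (2 * h)) x) \<partial>lborel)"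
    by (rule nn_integral_cmult) simp
  also have "(\<integral>\<^sup>+x. ennreal (normal_density 0 (sqrt (2 * h)) x) \<partial>lborel) = 1"
    using h integral_normal_density[of "sqrt (2 * h)" 0]
    by (subst nn_integral_eq_integral) auto
  finally show ?thesis by (simp add: h_def)
qed

text \<open>This is \<open>W\<close>. The factor \<open>2 ^ k\<close> normalises the increments to
  unit variance, and the weights are summable over all levels and all positions on the half-line.
  With values in \<open>ennreal\<close> the sum exists at every \<omega>, while finiteness is
  obtained almost surely.\<close>

definition dyadic_exp_sum :: "'a \<Rightarrow> ennreal" where
  "dyadic_exp_sum \<omega> = (\<Sum>k. \<Sum>j. ennreal ((1 / 2) ^ k / (real j + 1)\<^sup>2 *
     exp (2 ^ k * (B ((real j + 1) / 2 ^ k) \<omega> - B (real j / 2 ^ k) \<omega>)\<^sup>2 / 4)))"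

lemma measurable_dyadic_exp_sum [measurable]: "dyadic_exp_sum \<in> borel_measurable M"
  unfolding dyadic_exp_sum_def using measurable by measurable

text \<open>Expectation and sums of nonnegative terms commute. Each exponential has mean
  \<open>sqrt 2\<close>, which leaves a geometric series times the series of inverse
  squares.\<close>

lemma nn_integral_dyadic_exp_sum: "(\<integral>\<^sup>+\<omega>. dyadic_exp_sum \<omega> \<partial>M) < \<infinity>"
proof -
  have meas [measurable]: "B (real j / 2 ^ k) \<in> borel_measurable M"
    "B ((real j + 1) / 2 ^ k) \<in> borel_measurable M" for j k
    by (auto intro!: measurable)
  define F where "F k j \<omega> = ennreal ((1 / 2) ^ k / (real j + 1)\<^sup>2 *
     exp (2 ^ k * (B ((real j + 1) / 2 ^ k) \<omega> - B (real j / 2 ^ k) \<omega>)\<^sup>2 / 4))" for k j \<omega>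
  have F_meas [measurable]: "F k j \<in> borel_measurable M" for k j
    unfolding F_def by measurable
  have increment: "(\<integral>\<^sup>+\<omega>. F k j \<omega> \<partial>M) = ennreal (sqrt 2 * (1 / 2) ^ k * (1 / (real j + 1)\<^sup>2))" for k j
  proof -
    have "(real j + 1) / 2 ^ k - real j / 2 ^ k = 1 / 2 ^ k"
      by (simp add: diff_divide_distrib[symmetric])
    then have "(\<integral>\<^sup>+\<omega>. ennreal (exp (2 ^ k * (B ((real j + 1) / 2 ^ k) \<omega> - B (real j / 2 ^ k) \<omega>)\<^sup>2 / 4)) \<partial>M)
        = ennreal (sqrt 2)"
      using nn_integral_exp_square_increment[of "real j / 2 ^ k" "(real j + 1) / 2 ^ k"]
      by (simp add: divide_strict_right_mono mult.commute)
    moreover have "(\<integral>\<^sup>+\<omega>. F k j \<omega> \<partial>M)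
        = ennreal ((1 / 2) ^ k / (real j + 1)\<^sup>2) *
          (\<integral>\<^sup>+\<omega>. ennreal (exp (2 ^ k * (B ((real j + 1) / 2 ^ k) \<omega> - B (real j / 2 ^ k) \<omega>)\<^sup>2 / 4)) \<partial>M)"
      unfolding F_def by (subst ennreal_mult) (auto intro!: nn_integral_cmult)
    ultimately show ?thesis
      by (simp add: mult.commute flip: ennreal_mult)
  qed
  have "(\<integral>\<^sup>+\<omega>. dyadic_exp_sum \<omega> \<partial>M) = (\<Sum>k. \<Sum>j. ennreal (sqrt 2 * (1 / 2) ^ k * (1 / (real j + 1)\<^sup>2)))"
    unfolding dyadic_exp_sum_def F_def[symmetric] by (simp add: nn_integral_suminf increment)
  also have "\<dots> = (\<Sum>k. ennreal (sqrt 2 * (1 / 2) ^ k * (pi\<^sup>2 / 6)))"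
  proof (rule suminf_cong)
    fix k
    have "(\<lambda>j. sqrt 2 * (1 / 2) ^ k * (1 / (real j + 1)\<^sup>2)) sums (sqrt 2 * (1 / 2) ^ k * (pi\<^sup>2 / 6))"
      using inverse_squares_sums by (intro sums_mult) (simp add: add.commute)
    then show "(\<Sum>j. ennreal (sqrt 2 * (1 / 2) ^ k * (1 / (real j + 1)\<^sup>2)))
        = ennreal (sqrt 2 * (1 / 2) ^ k * (pi\<^sup>2 / 6))"
      by (intro suminf_ennreal_eq) auto
  qed
  also have "\<dots> < \<infinity>"
  proof -
    have "summable (\<lambda>k. sqrt 2 * (1 / 2 :: real) ^ k * (pi\<^sup>2 / 6))"
      by (intro summable_mult summable_mult2 summable_geometric) simp
    then have "(\<Sum>k. ennreal (sqrt 2 * (1 / 2) ^ k * (pi\<^sup>2 / 6))) \<noteq> top"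
      by (intro ennreal_suminf_neq_top) auto
    then show ?thesis
      unfolding infinity_ennreal_def less_top .
  qed
  finally show ?thesis .
qed

text \<open>The maximum with 1 makes the logarithm nonnegative, so that its square root can be used.
  Where the sum is infinite, \<open>enn2real\<close> returns 0 and the value is 0; path bounds are
  therefore stated under finiteness of the sum.\<close>

definition log_exp_sum :: "'a \<Rightarrow> real" where
  "log_exp_sum \<omega> = ln (max 1 (enn2real (dyadic_exp_sum \<omega>)))"

lemma measurable_log_exp_sum [measurable]: "log_exp_sum \<in> borel_measurable M"
  unfolding log_exp_sum_def by measurable

lemma log_exp_sum_nonneg: "0 \<le> log_exp_sum \<omega>"
  by (simp add: log_exp_sum_def)

text \<open>The exponential undoes the logarithm, and \<open>max 1 w \<le> 1 + w\<close> with
  \<open>W\<close> integrable.\<close>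

lemma nn_integral_exp_log_exp_sum: "(\<integral>\<^sup>+\<omega>. ennreal (exp (log_exp_sum \<omega>)) \<partial>M) < \<infinity>"
proof -
  have "ennreal (exp (log_exp_sum \<omega>)) \<le> 1 + dyadic_exp_sum \<omega>" for \<omega>
  proof (cases "dyadic_exp_sum \<omega>")
    case (real w)
    then have "ennreal (exp (log_exp_sum \<omega>)) = ennreal (max 1 w)"
      by (simp add: log_exp_sum_def)
    also have "\<dots> \<le> ennreal (1 + w)"
      using real by (intro ennreal_leI) auto
    finally show ?thesis
      using real by simp
  qed simp
  then have "(\<integral>\<^sup>+\<omega>. ennreal (exp (log_exp_sum \<omega>)) \<partial>M) \<le> (\<integral>\<^sup>+\<omega>. 1 + dyadic_exp_sum \<omega> \<partial>M)"
    by (intro nn_integral_mono)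
  also have "\<dots> = 1 + (\<integral>\<^sup>+\<omega>. dyadic_exp_sum \<omega> \<partial>M)"
    by (simp add: nn_integral_add emeasure_space_1)
  also have "\<dots> < \<infinity>"
    using nn_integral_dyadic_exp_sum by simp
  finally show ?thesis .
qed

section \<open>Modulus of continuity of the Brownian paths\<close>

lemma AE_dyadic_exp_sum_finite: "AE \<omega> in M. dyadic_exp_sum \<omega> \<noteq> \<infinity>"
  using nn_integral_dyadic_exp_sum by (intro nn_integral_noteq_infinite) auto

text \<open>One term of a nonnegative series is at most its sum, so taking logarithms bounds the
  squared normalised increment by \<open>log_exp_sum\<close> plus the logarithm of the inverse
  weight, up to the factor 4. The right side has the form that the chaining lemmas expect.\<close>

lemma dyadic_increment_bound:
  assumes fin: "dyadic_exp_sum \<omega> \<noteq> \<infinity>" and j: "real j < T * 2 ^ k"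
  shows "\<bar>B ((real j + 1) / 2 ^ k) \<omega> - B (real j / 2 ^ k) \<omega>\<bar>
    \<le> 8 * sqrt (1 / 2) ^ k * (sqrt (log_exp_sum \<omega>) + 1 + T + real k)"
proof -
  define d where "d = \<bar>B ((real j + 1) / 2 ^ k) \<omega> - B (real j / 2 ^ k) \<omega>\<bar>"
  define a where "a = (1 / 2 :: real) ^ k / (real j + 1)\<^sup>2"
  have "0 < a" by (simp add: a_def)
  have "0 < T"
    using j by (smt (verit) of_nat_0_le_iff zero_less_mult_pos2 zero_less_power)
  have "ennreal (a * exp (2 ^ k * d\<^sup>2 / 4)) \<le> dyadic_exp_sum \<omega>"
  proof -
    define F where "F k j = ennreal ((1 / 2) ^ k / (real j + 1)\<^sup>2 *
     exp (2 ^ k * (B ((real j + 1) / 2 ^ k) \<omega> - B (real j / 2 ^ k) \<omega>)\<^sup>2 / 4))" for k j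
    have "F k j \<le> (\<Sum>j. F k j)"
      using sum_le_suminf[of "F k" "{j}"] by simp
    also have "\<dots> \<le> (\<Sum>k. \<Sum>j. F k j)"
      using sum_le_suminf[of "\<lambda>k. \<Sum>j. F k j" "{k}"] by simp
    finally show ?thesis
      by (simp add: F_def dyadic_exp_sum_def a_def d_def)
  qed
  then have "a * exp (2 ^ k * d\<^sup>2 / 4) \<le> enn2real (dyadic_exp_sum \<omega>)"
    using fin \<open>0 < a\<close> by (cases "dyadic_exp_sum \<omega>") auto
  also have "\<dots> \<le> exp (log_exp_sum \<omega>)"
    by (simp add: log_exp_sum_def)
  finally have "ln (a * exp (2 ^ k * d\<^sup>2 / 4)) \<le> ln (exp (log_exp_sum \<omega>))"
    using \<open>0 < a\<close> by (subst ln_le_cancel_iff) auto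
  then have "2 ^ k * d\<^sup>2 / 4 \<le> log_exp_sum \<omega> - ln a"
    using \<open>0 < a\<close> by (simp add: ln_mult)
  \<comment> \<open>The level weight contributes at most \<open>k\<close>. The position weight
    contributes \<open>2 * ln (j + 1)\<close>, at most \<open>2 * (T + k)\<close> because
    \<open>j + 1 \<le> (T + 1) * 2 ^ k\<close>.\<close>
  moreover have "- ln a \<le> 3 * real k + 2 * T"
  proof -
    have "real j + 1 \<le> (T + 1) * 2 ^ k"
      using j one_le_power[of "2::real" k] unfolding ring_distribs by linarith
    then have "ln (real j + 1) \<le> ln ((T + 1) * 2 ^ k)"
      using \<open>0 < T\<close> by (subst ln_le_cancel_iff) auto
    also have "\<dots> = ln (T + 1) + real k * ln 2"
      using \<open>0 < T\<close> by (simp add: ln_mult ln_realpow)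
    also have "\<dots> \<le> T + real k * 1"
      using \<open>0 < T\<close> ln_add_one_self_le_self[of T] ln_2_less_1
      by (intro add_mono mult_left_mono) (auto simp: add.commute)
    finally have "ln (real j + 1) \<le> T + real k" by simp
    moreover have "- ln a = real k * ln 2 + 2 * ln (real j + 1)"
      by (simp add: a_def ln_div ln_realpow)
    moreover have "real k * ln 2 \<le> real k * 1"
      using ln_2_less_1 by (intro mult_left_mono) auto
    ultimately show ?thesis by linarith
  qed
  ultimately have "2 ^ k * d\<^sup>2 \<le> 4 * (log_exp_sum \<omega> + (3 * real k + 2 * T))"
    by simp
  then have "sqrt (2 ^ k * d\<^sup>2) \<le> sqrt (4 * (log_exp_sum \<omega> + (3 * real k + 2 * T)))"
    by (rule real_sqrt_le_mono)
  also have "\<dots> = 2 * sqrt (log_exp_sum \<omega> + (3 * real k + 2 * T))"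
    by (subst real_sqrt_mult) simp
  also have "\<dots> \<le> 2 * (sqrt (log_exp_sum \<omega>) + sqrt (3 * real k + 2 * T))"
    using log_exp_sum_nonneg \<open>0 < T\<close> by (intro mult_left_mono sqrt_add_le_add_sqrt) auto
  \<comment> \<open>Only the deterministic root is linearised. This turns \<open>sqrt k\<close> into
    \<open>k\<close>, and hence a root of the logarithm into the logarithm of the claimed rate; the
    random part has to stay under its root for the sake of the moments.\<close>
  also have "\<dots> \<le> 2 * (sqrt (log_exp_sum \<omega>) + (1 + (3 * real k + 2 * T)))"
  proof -
    define y where "y = 3 * real k + 2 * T"
    have "0 \<le> y" using \<open>0 < T\<close> by (simp add: y_def)
    then have "sqrt y \<le> 1 + y"
      by (intro real_le_lsqrt) (auto simp: power2_eq_square algebra_simps)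
    then show ?thesis by (simp add: y_def)
  qed
  also have "\<dots> \<le> 8 * (sqrt (log_exp_sum \<omega>) + 1 + T + real k)"
    using log_exp_sum_nonneg[of \<omega>] \<open>0 < T\<close> by simp
  finally have *: "sqrt (2 ^ k * d\<^sup>2) \<le> 8 * (sqrt (log_exp_sum \<omega>) + 1 + T + real k)" .
  have "d = sqrt (1 / 2) ^ k * sqrt (2 ^ k * d\<^sup>2)"
  proof -
    have "(sqrt (1 / 2) ^ k * sqrt (2 ^ k * d\<^sup>2))\<^sup>2 = d\<^sup>2"
      by (simp only: power_mult_distrib sqrt_half_power_square) (simp add: power_divide)
    moreover have "0 \<le> sqrt (1 / 2) ^ k * sqrt (2 ^ k * d\<^sup>2)" "0 \<le> d"
      by (auto simp: d_def)
    ultimately show ?thesis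
      by (rule power2_eq_imp_eq[symmetric])
  qed
  also have "\<dots> \<le> sqrt (1 / 2) ^ k * (8 * (sqrt (log_exp_sum \<omega>) + 1 + T + real k))"
    by (rule mult_left_mono[OF *]) simp
  finally show ?thesis
    unfolding d_def[symmetric] by (simp only: mult_ac)
qed

text \<open>The mesh \<open>2 ^ -m\<close> is taken of order \<open>y ^ -2\<close>, so that \<open>sqrt (2 ^ -m)\<close> is
  of order \<open>1 / y\<close> and only boundedly many steps of the mesh, up to a factor \<open>1 + D * t\<close>,
  separate the two clock values; \<open>m\<close> is of order \<open>ln y\<close>.\<close>

lemma increment_at_small_scale:
  assumes fin: "dyadic_exp_sum \<omega> \<noteq> \<infinity>" and cont: "continuous_on {0..} (\<lambda>t. B t \<omega>)"
    and "1 \<le> y" and u: "0 \<le> u" "u < T" and v: "0 \<le> v" "v < T"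
    and close: "\<bar>v - u\<bar> * y\<^sup>2 \<le> D" and "0 \<le> D"
  shows "\<bar>B v \<omega> - B u \<omega>\<bar>
    \<le> 16 / y * (D + 9) * (T + 5) * (sqrt (log_exp_sum \<omega>) + 1) * (1 + 2 * ln y / ln 2)"
proof -
  define m where "m = nat \<lfloor>log 2 (y\<^sup>2)\<rfloor>"
  have log: "log 2 (y\<^sup>2) = 2 * ln y / ln 2"
    using \<open>1 \<le> y\<close> by (simp add: log_def ln_realpow)
  have "0 \<le> log 2 (y\<^sup>2)"
    using \<open>1 \<le> y\<close> by (simp add: log)
  then have m: "real m \<le> log 2 (y\<^sup>2)" "log 2 (y\<^sup>2) < real (m + 1)"
    unfolding m_def by linarith+
  \<comment> \<open>This half of the floor bounds the number of mesh steps through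
    \<open>close\<close>; the next one bounds \<open>sqrt (1 / 2) ^ m\<close>.\<close>
  have "2 ^ m \<le> y\<^sup>2"
    using m(1) \<open>1 \<le> y\<close> by (simp add: le_log_iff powr_realpow)
  have "y\<^sup>2 < 2 ^ (m + 1)"
    using m(2) \<open>1 \<le> y\<close> powr_realpow[of 2 "m + 1"] by (subst (asm) log_less_iff) auto
  have "sqrt (1 / 2) ^ m \<le> 2 / y"
  proof -
    have "(y * sqrt (1 / 2) ^ m)\<^sup>2 = y\<^sup>2 / 2 ^ m"
      by (simp only: power_mult_distrib sqrt_half_power_square) (simp add: power_divide)
    also have "\<dots> \<le> 2\<^sup>2"
    proof -
      have "y\<^sup>2 / 2 ^ m \<le> (2 ^ m * 2) / 2 ^ m"
        using \<open>y\<^sup>2 < 2 ^ (m + 1)\<close> by (intro divide_right_mono) auto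
      then show ?thesis by simp
    qed
    finally have "y * sqrt (1 / 2) ^ m \<le> 2"
      by (rule power2_le_imp_le) simp
    then show ?thesis
      using \<open>1 \<le> y\<close> by (simp add: field_simps)
  qed
  \<comment> \<open>With this \<open>A\<close> and the constant 8,
    \<open>dyadic_increment_bound\<close> is the increment hypothesis of
    \<open>dyadic_modulus\<close>.\<close>
  define A where "A = sqrt (log_exp_sum \<omega>) + 1 + T"
  have "0 \<le> A" using log_exp_sum_nonneg u by (simp add: A_def)
  have "\<bar>B v \<omega> - B u \<omega>\<bar> \<le> 8 * sqrt (1 / 2) ^ m * (\<bar>v - u\<bar> * 2 ^ m + 9) * (A + real m + 4)"
    using dyadic_modulus[OF cont \<open>0 \<le> A\<close> _ _ u v, of 8 m] dyadic_increment_bound[OF fin]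
    by (simp add: A_def)
  also have "\<dots> \<le> 8 * (2 / y) * (D + 9) *
      ((T + 5) * (sqrt (log_exp_sum \<omega>) + 1) * (1 + 2 * ln y / ln 2))"
  proof (intro mult_mono)
    have "\<bar>v - u\<bar> * 2 ^ m \<le> \<bar>v - u\<bar> * y\<^sup>2"
      using \<open>2 ^ m \<le> y\<^sup>2\<close> by (intro mult_left_mono) auto
    with close show "\<bar>v - u\<bar> * 2 ^ m + 9 \<le> D + 9" by simp
    define a s where "a = sqrt (log_exp_sum \<omega>)" and "s = 2 * ln y / ln 2"
    have pos: "0 \<le> a" "0 \<le> s" "real m \<le> s" "0 \<le> T"
      using log_exp_sum_nonneg m \<open>1 \<le> y\<close> u log by (auto simp: a_def s_def)
    \<comment> \<open>Bounding the sum by a product separates the random factor from those carrying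
      \<open>T\<close> and \<open>y\<close>, so that a single random variable can serve every time
      and every \<open>N\<close>.\<close>
    have "a + 1 + T + s + 4 \<le> (T + 5) * (a + 1) * (1 + s)"
    proof -
      have "0 \<le> T * a + 4 * a + T * s + 4 * s + T * a * s + 5 * (a * s)" using pos by simp
      then show ?thesis by (simp add: algebra_simps)
    qed
    with pos show "A + real m + 4 \<le> (T + 5) * (sqrt (log_exp_sum \<omega>) + 1) * (1 + 2 * ln y / ln 2)"
      unfolding A_def a_def[symmetric] s_def[symmetric] by linarith
  qed (use \<open>sqrt (1 / 2) ^ m \<le> 2 / y\<close> \<open>1 \<le> y\<close> \<open>0 \<le> D\<close> \<open>0 \<le> A\<close> in auto)
  finally show ?thesis by (simp add: mult_ac)
qed

end

text \<open>This absorbs the growth in time: \<open>1 \<le> exp (\<eta> * t)\<close> handles the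
  constant and \<open>\<eta> * t \<le> exp (\<eta> * t)\<close> the linear term.\<close>

lemma affine_le_exp:
  fixes t :: real
  assumes "0 \<le> c" "0 \<le> d" "0 < \<eta>" "0 \<le> t"
  shows "c + d * t \<le> (c + d / \<eta>) * exp (\<eta> * t)"
proof -
  have "c * 1 \<le> c * exp (\<eta> * t)"
    using assms by (intro mult_left_mono) auto
  moreover have "\<eta> * t \<le> exp (\<eta> * t)"
    using exp_ge_add_one_self[of "\<eta> * t"] by linarith
  then have "d / \<eta> * (\<eta> * t) \<le> d / \<eta> * exp (\<eta> * t)"
    using assms by (intro mult_left_mono) auto
  ultimately show ?thesis
    using assms by (simp add: ring_distribs)
qed

section \<open>Comparison of the two solutions\<close>

theorem corollary3:
  fixes M :: "'a measure"
    and B :: "real \<Rightarrow> 'a \<Rightarrow> real"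
    and \<alpha> L_b K_b K_\<sigma> D_b D_\<sigma> D_x x0 \<eta> :: real
    and b :: "real \<Rightarrow> real \<Rightarrow> real" and \<sigma> :: "real \<Rightarrow> real"
    and b\<^sub>N :: "nat \<Rightarrow> real \<Rightarrow> real \<Rightarrow> real" and \<sigma>\<^sub>N :: "nat \<Rightarrow> real \<Rightarrow> real"
    and x0\<^sub>N :: "nat \<Rightarrow> real"
    and X :: "real \<Rightarrow> 'a \<Rightarrow> real" and X\<^sub>N :: "nat \<Rightarrow> real \<Rightarrow> 'a \<Rightarrow> real"
  assumes "standard_brownian_motion M B"
    and "\<alpha> > 0" and "L_b \<ge> 0" and "K_b \<ge> 0" and "K_\<sigma> \<ge> 0"
    and "\<And>t x y. t \<ge> 0 \<Longrightarrow> \<bar>b t x - b t y\<bar> \<le> L_b * \<bar>x - y\<bar>"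
    and "\<And>t x. t \<ge> 0 \<Longrightarrow> \<bar>b t x\<bar> \<le> K_b"
    and "\<And>t. t \<ge> 0 \<Longrightarrow> (\<sigma> t)\<^sup>2 \<le> K_\<sigma>"
    and "\<And>N t x. N > 2 \<Longrightarrow> t \<ge> 0 \<Longrightarrow> b\<^sub>N N t x = b t x + real N powr (- \<alpha>) * D_b"
    and "\<And>N t. N > 2 \<Longrightarrow> t \<ge> 0 \<Longrightarrow> (\<sigma> t)\<^sup>2 + real N powr (- 2 * \<alpha>) * D_\<sigma> \<ge> 0"
    and "\<And>N t. N > 2 \<Longrightarrow> t \<ge> 0 \<Longrightarrow> (\<sigma>\<^sub>N N t)\<^sup>2 = (\<sigma> t)\<^sup>2 + real N powr (- 2 * \<alpha>) * D_\<sigma>"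
    and "\<And>N. N > 2 \<Longrightarrow> x0\<^sub>N N = x0 + real N powr (- \<alpha>) * D_x"
    and "\<And>N. N > 2 \<Longrightarrow> time_changed_solution M B (b\<^sub>N N) (\<sigma>\<^sub>N N) (x0\<^sub>N N) (X\<^sub>N N)"
    and "time_changed_solution M B b \<sigma> x0 X"
    and "\<eta> > 0"
  shows "\<exists>\<Xi> \<in> borel_measurable M.
    admits_exponential_moments M (\<lambda>\<omega>. (\<Xi> \<omega>)\<^sup>2) \<and>
    (\<forall>N>2. AE \<omega> in M.
       (SUP t\<in>{0..}. ereal (\<bar>X\<^sub>N N t \<omega> - X t \<omega>\<bar> / exp (2 * (L_b + \<eta>) * t)))
         \<le> ereal (\<Xi> \<omega> * (ln (real N) / real N powr \<alpha>)))"
proof -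
  interpret standard_brownian_motion M B by fact
  \<comment> \<open>\<open>q\<close> bounds the growth rate of both clocks. \<open>P\<close>
    collects the two factors of the noise bound that are affine in \<open>t\<close>, after
    \<open>affine_le_exp\<close>. \<open>C\<close> adds the errors from initial value, drift and
    noise, and the 2 in \<open>\<Xi>\<close> is the Gronwall constant.\<close>
  define q where "q = K_\<sigma> + \<bar>D_\<sigma>\<bar>"
  define P where "P = (9 + \<bar>D_\<sigma>\<bar> / \<eta>) * (6 + q / \<eta>)"
  define C where "C = \<bar>D_x\<bar> + \<bar>D_b\<bar> / \<eta> + 16 * P * (1 + 2 * \<alpha> / ln 2)"
  define R where "R \<omega> = sqrt (log_exp_sum \<omega>) + 1" for \<omega>
  define \<Xi> where "\<Xi> \<omega> = 2 * C * R \<omega>" for \<omega>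
  have "0 \<le> q" using \<open>0 \<le> K_\<sigma>\<close> by (simp add: q_def)
  have "0 < P"
    using \<open>0 \<le> q\<close> \<open>0 < \<eta>\<close> unfolding P_def by (intro mult_pos_pos add_pos_nonneg) auto
  then have "0 < C"
    using \<open>0 < \<alpha>\<close> \<open>0 < \<eta>\<close> unfolding C_def by (intro add_nonneg_pos mult_pos_pos add_pos_nonneg) auto
  have R: "1 \<le> R \<omega>" for \<omega>
    using log_exp_sum_nonneg by (simp add: R_def)
  have \<Xi>_meas: "\<Xi> \<in> borel_measurable M"
    unfolding \<Xi>_def R_def by measurable

  \<comment> \<open>Exponential moments of the square of \<open>\<Xi>\<close>\<close>
  have moments: "admits_exponential_moments M (\<lambda>\<omega>. (\<Xi> \<omega>)\<^sup>2)"
    unfolding admits_exponential_moments_def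
  proof (intro conjI exI)
    \<comment> \<open>With this parameter the exponent is half the square of
      \<open>R \<omega>\<close>, hence at most \<open>1 + log_exp_sum \<omega>\<close>, whose
      exponential is integrable.\<close>
    show "0 < 1 / (8 * C\<^sup>2)" using \<open>0 < C\<close> by simp
    have "1 / (8 * C\<^sup>2) * (\<Xi> \<omega>)\<^sup>2 \<le> 1 + log_exp_sum \<omega>" for \<omega>
    proof -
      have "(R \<omega>)\<^sup>2 + (sqrt (log_exp_sum \<omega>) - 1)\<^sup>2 = 2 * (1 + (sqrt (log_exp_sum \<omega>))\<^sup>2)"
        by (simp add: R_def power2_eq_square algebra_simps)
      then have "(R \<omega>)\<^sup>2 \<le> 2 * (1 + log_exp_sum \<omega>)"
        using log_exp_sum_nonneg[of \<omega>] zero_le_power2[of "sqrt (log_exp_sum \<omega>) - 1"]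
        unfolding real_sqrt_pow2[OF log_exp_sum_nonneg] by linarith
      then show ?thesis
        using \<open>0 < C\<close> by (simp add: \<Xi>_def power_mult_distrib)
    qed
    then have "(\<integral>\<^sup>+\<omega>. ennreal (exp (1 / (8 * C\<^sup>2) * (\<Xi> \<omega>)\<^sup>2)) \<partial>M)
        \<le> (\<integral>\<^sup>+\<omega>. ennreal (exp 1) * ennreal (exp (log_exp_sum \<omega>)) \<partial>M)"
      by (intro nn_integral_mono) (simp flip: ennreal_mult exp_add)
    also have "\<dots> < \<infinity>"
      using nn_integral_exp_log_exp_sum by (simp add: nn_integral_cmult ennreal_mult_less_top)
    finally show "(\<integral>\<^sup>+\<omega>. ennreal (exp (1 / (8 * C\<^sup>2) * (\<Xi> \<omega>)\<^sup>2)) \<partial>M) < \<infinity>" .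
  qed (use \<Xi>_meas in auto)

  \<comment> \<open>Almost sure estimate for a fixed \<open>N\<close>\<close>
  have main: "AE \<omega> in M.
       (SUP t\<in>{0..}. ereal (\<bar>X\<^sub>N N t \<omega> - X t \<omega>\<bar> / exp (2 * (L_b + \<eta>) * t)))
         \<le> ereal (\<Xi> \<omega> * (ln (real N) / real N powr \<alpha>))" if "N > 2" for N
  proof -
    define y where "y = real N powr \<alpha>"
    have "1 \<le> y"
      using \<open>N > 2\<close> \<open>0 < \<alpha>\<close> by (simp add: y_def ge_one_powr_ge_zero)
    have powr1: "real N powr (- \<alpha>) = 1 / y"
      by (simp add: y_def powr_minus_divide)
    have powr2: "real N powr (- 2 * \<alpha>) = 1 / y\<^sup>2"
      by (simp add: y_def powr_minus_divide power2_eq_square flip: powr_add)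
    have ln_y: "ln y = \<alpha> * ln (real N)"
      using \<open>N > 2\<close> by (simp add: y_def)
    \<comment> \<open>Here \<open>N > 2\<close> enters through \<open>N \<ge> 3 \<ge> exp 1\<close>:
      terms without a logarithm can be absorbed into \<open>ln N\<close>.\<close>
    have "1 \<le> ln (real N)"
      using \<open>N > 2\<close> exp_le ln_ge_iff[of "real N" 1] by auto
    have sq_int: "(\<lambda>s. (\<sigma> s)\<^sup>2) integrable_on {0..t}" if "0 \<le> t" for t
      using assms(14) that by (simp add: time_changed_solution_def)
    have sqN_int: "(\<lambda>s. (\<sigma>\<^sub>N N s)\<^sup>2) integrable_on {0..t}" if "0 \<le> t" for t
      using assms(13)[OF \<open>N > 2\<close>] that by (simp add: time_changed_solution_def)
    \<comment> \<open>Both clocks are deterministic, as the diffusion coefficients do not depend on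
      space. The noise terms thus read the same path at times of distance of order
      \<open>t / y\<^sup>2\<close>.\<close>
    have clockN: "clock (\<sigma>\<^sub>N N) t = clock \<sigma> t + D_\<sigma> / y\<^sup>2 * t" if "0 \<le> t" for t
    proof -
      have "clock (\<sigma>\<^sub>N N) t = integral {0..t} (\<lambda>s. (\<sigma> s)\<^sup>2 + D_\<sigma> / y\<^sup>2)"
        unfolding clock_def
        by (intro integral_cong) (use assms(11)[OF \<open>N > 2\<close>] in \<open>simp add: powr2[simplified]\<close>)
      also have "\<dots> = clock \<sigma> t + integral {0..t} (\<lambda>s. D_\<sigma> / y\<^sup>2)"
        unfolding clock_def using sq_int[OF that] by (intro integral_add) auto
      finally show ?thesis using that by simp
    qed
    have clock_nonneg: "0 \<le> clock \<sigma> t" "0 \<le> clock (\<sigma>\<^sub>N N) t" if "0 \<le> t" for t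
      unfolding clock_def using sq_int[OF that] sqN_int[OF that] by (auto intro!: integral_nonneg)
    have clock_le: "clock \<sigma> t \<le> K_\<sigma> * t" if "0 \<le> t" for t
    proof -
      have "clock \<sigma> t \<le> integral {0..t} (\<lambda>s. K_\<sigma>)"
        unfolding clock_def using sq_int[OF that] assms(8) by (intro integral_le) auto
      then show ?thesis using that by (simp add: mult.commute)
    qed
    have noise: "\<bar>B (clock (\<sigma>\<^sub>N N) t) \<omega> - B (clock \<sigma> t) \<omega>\<bar>
        \<le> 16 * P * (1 + 2 * \<alpha> / ln 2) * (R \<omega> * ln (real N) / y) * exp (2 * \<eta> * t)"
      if fin: "dyadic_exp_sum \<omega> \<noteq> \<infinity>" and cont: "continuous_on {0..} (\<lambda>t. B t \<omega>)" and "0 \<le> t"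
      for \<omega> t
    proof -
      have "D_\<sigma> / y\<^sup>2 * t \<le> \<bar>D_\<sigma>\<bar> * t"
      proof (rule mult_right_mono)
        have "D_\<sigma> / y\<^sup>2 \<le> \<bar>D_\<sigma>\<bar> / y\<^sup>2" by (intro divide_right_mono) auto
        also have "\<dots> \<le> \<bar>D_\<sigma>\<bar> / 1"
          using \<open>1 \<le> y\<close> by (intro divide_left_mono) auto
        finally show "D_\<sigma> / y\<^sup>2 \<le> \<bar>D_\<sigma>\<bar>" by simp
      qed fact
      \<comment> \<open>The added 1 makes both inequalities strict, also at \<open>t = 0\<close>, as
        the modulus of continuity demands of its horizon.\<close>
      then have range: "clock \<sigma> t < q * t + 1" "clock (\<sigma>\<^sub>N N) t < q * t + 1"
        using clock_le[OF \<open>0 \<le> t\<close>] \<open>0 \<le> t\<close>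
          mult_nonneg_nonneg[OF abs_ge_zero[of D_\<sigma>] \<open>0 \<le> t\<close>]
        unfolding clockN[OF \<open>0 \<le> t\<close>] q_def ring_distribs by linarith+
      have close: "\<bar>clock (\<sigma>\<^sub>N N) t - clock \<sigma> t\<bar> * y\<^sup>2 \<le> \<bar>D_\<sigma>\<bar> * t"
        using \<open>0 \<le> t\<close> \<open>1 \<le> y\<close> by (simp add: clockN abs_mult)
      have "\<bar>B (clock (\<sigma>\<^sub>N N) t) \<omega> - B (clock \<sigma> t) \<omega>\<bar>
          \<le> 16 / y * (\<bar>D_\<sigma>\<bar> * t + 9) * (q * t + 1 + 5) * R \<omega> * (1 + 2 * ln y / ln 2)"
        unfolding R_def
        using \<open>0 \<le> t\<close> \<open>1 \<le> y\<close>
        by (intro increment_at_small_scale fin cont clock_nonneg range close) auto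
      also have "\<dots> = 16 / y * R \<omega> * (((9 + \<bar>D_\<sigma>\<bar> * t) * (6 + q * t)) * (1 + 2 * ln y / ln 2))"
      proof -
        have "\<bar>D_\<sigma>\<bar> * t + 9 = 9 + \<bar>D_\<sigma>\<bar> * t" "q * t + 1 + 5 = 6 + q * t"
          by simp_all
        then show ?thesis by (simp only: mult_ac)
      qed
      also have "\<dots> \<le> 16 / y * R \<omega> * ((P * exp (2 * \<eta> * t)) * ((1 + 2 * \<alpha> / ln 2) * ln (real N)))"
      proof (rule mult_left_mono[OF mult_mono])
        have "(9 + \<bar>D_\<sigma>\<bar> * t) * (6 + q * t)
            \<le> ((9 + \<bar>D_\<sigma>\<bar> / \<eta>) * exp (\<eta> * t)) * ((6 + q / \<eta>) * exp (\<eta> * t))"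
          using \<open>0 \<le> t\<close> \<open>0 \<le> q\<close> \<open>0 < \<eta>\<close> by (intro mult_mono affine_le_exp) auto
        also have "\<dots> = P * exp (2 * \<eta> * t)"
        proof -
          have "exp (2 * \<eta> * t) = exp (\<eta> * t) * exp (\<eta> * t)"
            by (simp flip: exp_add)
          then show ?thesis by (simp only: P_def mult_ac)
        qed
        finally show "(9 + \<bar>D_\<sigma>\<bar> * t) * (6 + q * t) \<le> P * exp (2 * \<eta> * t)" .
        \<comment> \<open>Since \<open>ln y = \<alpha> * ln N\<close>, only the leading 1 needs the
          bound \<open>1 \<le> ln N\<close>.\<close>
        show "1 + 2 * ln y / ln 2 \<le> (1 + 2 * \<alpha> / ln 2) * ln (real N)"
          using \<open>1 \<le> ln (real N)\<close> by (simp add: ln_y ring_distribs)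
      qed (use \<open>0 < P\<close> \<open>1 \<le> y\<close> R[of \<omega>] in auto)
      finally show ?thesis by (simp add: divide_inverse mult_ac)
    qed
    have "AE \<omega> in M. continuous_on {0..} (\<lambda>t. X\<^sub>N N t \<omega>) \<and>
        (\<forall>t\<ge>0. (\<lambda>s. b\<^sub>N N s (X\<^sub>N N s \<omega>)) integrable_on {0..t} \<and>
           X\<^sub>N N t \<omega> = x0\<^sub>N N + integral {0..t} (\<lambda>s. b\<^sub>N N s (X\<^sub>N N s \<omega>)) + B (clock (\<sigma>\<^sub>N N) t) \<omega>)"
      using assms(13)[OF \<open>N > 2\<close>] by (simp add: time_changed_solution_def)
    moreover have "AE \<omega> in M. continuous_on {0..} (\<lambda>t. X t \<omega>) \<and>
        (\<forall>t\<ge>0. (\<lambda>s. b s (X s \<omega>)) integrable_on {0..t} \<and>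
           X t \<omega> = x0 + integral {0..t} (\<lambda>s. b s (X s \<omega>)) + B (clock \<sigma> t) \<omega>)"
      using assms(14) by (simp add: time_changed_solution_def)
    \<comment> \<open>Each of the four almost sure events concerns the whole path, so one null set
      serves all times and the supremum can be bounded pointwise.\<close>
    ultimately show ?thesis
      using AE_dyadic_exp_sum_finite continuous_paths
    proof eventually_elim
      case (elim \<omega>)
      define u where "u t = \<bar>X\<^sub>N N t \<omega> - X t \<omega>\<bar>" for t
      \<comment> \<open>The summand \<open>2 * L_b\<close> provides the Gronwall condition, and
        \<open>2 * \<eta>\<close> absorbs the growth of the error terms.\<close>
      define \<kappa> where "\<kappa> = 2 * (L_b + \<eta>)"
      define \<rho> where "\<rho> = R \<omega> * ln (real N) / y"
      have cont_u: "continuous_on {0..} u"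
        unfolding u_def using elim by (intro continuous_intros) auto
      \<comment> \<open>The initial value and drift errors are of order \<open>1 / y\<close>, so
        they fit under the noise scale \<open>\<rho>\<close>.\<close>
      have inv_y: "1 / y \<le> \<rho>"
        unfolding \<rho>_def
      proof (rule divide_right_mono)
        show "1 \<le> R \<omega> * ln (real N)"
          using mult_mono[OF R[of \<omega>] \<open>1 \<le> ln (real N)\<close>] R[of \<omega>] by simp
      qed (use \<open>1 \<le> y\<close> in simp)
      have "0 \<le> \<rho>"
        using R[of \<omega>] \<open>1 \<le> ln (real N)\<close> \<open>1 \<le> y\<close> by (simp add: \<rho>_def)
      have "u t \<le> C * \<rho> * exp (\<kappa> * t) + L_b * integral {0..t} u" if "0 \<le> t" for t
      proof -
        let ?d = "\<lambda>s. b\<^sub>N N s (X\<^sub>N N s \<omega>) - b s (X s \<omega>)"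
        have u_int: "u integrable_on {0..t}"
          by (intro integrable_continuous_real continuous_on_subset[OF cont_u]) auto
        have u_int': "(\<lambda>s. L_b * u s) integrable_on {0..t}"
          using u_int by (rule integrable_on_mult_right)
        have const_int: "(\<lambda>s. \<bar>D_b\<bar> / y) integrable_on {0..t}"
          by (rule integrable_const_ivl)
        have "norm (integral {0..t} ?d) \<le> integral {0..t} (\<lambda>s. L_b * u s + \<bar>D_b\<bar> / y)"
        proof (rule integral_norm_bound_integral)
          show "?d integrable_on {0..t}"
            using elim that by (intro integrable_diff) blast+
          show "(\<lambda>s. L_b * u s + \<bar>D_b\<bar> / y) integrable_on {0..t}"
            using u_int' const_int by (rule integrable_add)
          fix s assume s: "s \<in> {0..t}"
          then have "norm (?d s) = \<bar>b s (X\<^sub>N N s \<omega>) - b s (X s \<omega>) + D_b / y\<bar>"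
            using assms(9)[OF \<open>N > 2\<close>] by (simp add: powr1)
          moreover have "\<bar>D_b / y\<bar> = \<bar>D_b\<bar> / y"
            using \<open>1 \<le> y\<close> by simp
          ultimately show "norm (?d s) \<le> L_b * u s + \<bar>D_b\<bar> / y"
            using assms(6)[of s "X\<^sub>N N s \<omega>" "X s \<omega>"] s
            unfolding u_def atLeastAtMost_iff by linarith
        qed
        also have "\<dots> = L_b * integral {0..t} u + \<bar>D_b\<bar> / y * t"
          unfolding integral_add[OF u_int' const_int] using that by simp
        finally have drift: "\<bar>integral {0..t} ?d\<bar> \<le> L_b * integral {0..t} u + \<bar>D_b\<bar> / y * t"
          by simp
        have "X\<^sub>N N t \<omega> - X t \<omega> = D_x / y + integral {0..t} ?d
            + (B (clock (\<sigma>\<^sub>N N) t) \<omega> - B (clock \<sigma> t) \<omega>)"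
        proof -
          have N_eq: "X\<^sub>N N t \<omega> = x0\<^sub>N N + integral {0..t} (\<lambda>s. b\<^sub>N N s (X\<^sub>N N s \<omega>)) + B (clock (\<sigma>\<^sub>N N) t) \<omega>"
            and N_int: "(\<lambda>s. b\<^sub>N N s (X\<^sub>N N s \<omega>)) integrable_on {0..t}"
            and eq: "X t \<omega> = x0 + integral {0..t} (\<lambda>s. b s (X s \<omega>)) + B (clock \<sigma> t) \<omega>"
            and int: "(\<lambda>s. b s (X s \<omega>)) integrable_on {0..t}"
            using elim that by blast+
          show ?thesis
            unfolding integral_diff[OF N_int int] unfolding N_eq eq assms(12)[OF \<open>N > 2\<close>] powr1
            by simp
        qed
        moreover have "\<bar>D_x / y\<bar> = \<bar>D_x\<bar> * (1 / y)" "\<bar>D_b\<bar> / y * t = \<bar>D_b\<bar> * t * (1 / y)"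
          using \<open>1 \<le> y\<close> by auto
        ultimately have "u t \<le> (\<bar>D_x\<bar> + \<bar>D_b\<bar> * t) * (1 / y) + L_b * integral {0..t} u
            + \<bar>B (clock (\<sigma>\<^sub>N N) t) \<omega> - B (clock \<sigma> t) \<omega>\<bar>"
          using drift unfolding u_def ring_distribs by linarith
        moreover have "(\<bar>D_x\<bar> + \<bar>D_b\<bar> * t) * (1 / y)
            \<le> (\<bar>D_x\<bar> + \<bar>D_b\<bar> / \<eta>) * exp (2 * \<eta> * t) * \<rho>"
        proof (rule mult_mono)
          have "\<bar>D_x\<bar> + \<bar>D_b\<bar> * t \<le> (\<bar>D_x\<bar> + \<bar>D_b\<bar> / \<eta>) * exp (\<eta> * t)"
            using \<open>0 < \<eta>\<close> \<open>0 \<le> t\<close> by (intro affine_le_exp) auto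
          also have "\<dots> \<le> (\<bar>D_x\<bar> + \<bar>D_b\<bar> / \<eta>) * exp (2 * \<eta> * t)"
            using \<open>0 < \<eta>\<close> \<open>0 \<le> t\<close> by (intro mult_left_mono) auto
          finally show "\<bar>D_x\<bar> + \<bar>D_b\<bar> * t \<le> (\<bar>D_x\<bar> + \<bar>D_b\<bar> / \<eta>) * exp (2 * \<eta> * t)" .
        qed (use \<open>0 < \<eta>\<close> \<open>1 \<le> y\<close> inv_y in auto)
        moreover have "\<bar>B (clock (\<sigma>\<^sub>N N) t) \<omega> - B (clock \<sigma> t) \<omega>\<bar>
            \<le> 16 * P * (1 + 2 * \<alpha> / ln 2) * \<rho> * exp (2 * \<eta> * t)"
          unfolding \<rho>_def using elim that by (intro noise) auto
        moreover have "C * \<rho> * exp (2 * \<eta> * t) = (\<bar>D_x\<bar> + \<bar>D_b\<bar> / \<eta>) * exp (2 * \<eta> * t) * \<rho>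
            + 16 * P * (1 + 2 * \<alpha> / ln 2) * \<rho> * exp (2 * \<eta> * t)"
          by (simp only: C_def ring_distribs mult_ac)
        moreover have "C * \<rho> * exp (2 * \<eta> * t) \<le> C * \<rho> * exp (\<kappa> * t)"
          using \<open>0 < C\<close> \<open>0 \<le> \<rho>\<close> \<open>0 \<le> t\<close> \<open>0 \<le> L_b\<close>
          by (intro mult_left_mono) (auto simp: \<kappa>_def ring_distribs)
        ultimately show ?thesis by linarith
      qed
      then have "u t \<le> 2 * (C * \<rho>) * exp (\<kappa> * t)" if "0 \<le> t" for t
        using that \<open>0 \<le> L_b\<close> \<open>0 < \<eta>\<close>
        by (intro weighted_gronwall[OF cont_u, where L = L_b]) (auto simp: u_def \<kappa>_def)
      then have u_bound: "u t / exp (\<kappa> * t) \<le> \<Xi> \<omega> * (ln (real N) / y)" if "0 \<le> t" for t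
        using that by (simp add: \<Xi>_def \<rho>_def pos_divide_le_eq mult.assoc)
      show ?case
      proof (rule SUP_least)
        fix t :: real assume "t \<in> {0..}"
        then show "ereal (\<bar>X\<^sub>N N t \<omega> - X t \<omega>\<bar> / exp (2 * (L_b + \<eta>) * t))
            \<le> ereal (\<Xi> \<omega> * (ln (real N) / real N powr \<alpha>))"
          using u_bound[of t] unfolding u_def \<kappa>_def y_def by simp
      qed
    qed
  qed
  show ?thesis
    using \<Xi>_meas moments main by blast
qed

end
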